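(* Suppose $\mathcal Q$ is vertically unbounded, $m=1$ (i.e. $\mathcal Q$ consists of polynomials of degree one) and $v(p)\in H$. Then $d=1$ and $B^{ct}=\{1,2,\dots,D\}$.
   Context: Let $(K,v)$ be a valued field and $p$ the characteristic exponent of its residue field ($p=1$ if the residue characteristic is $0$, otherwise $p$ is the residue characteristic); $v(p)$ denotes the value of $p\cdot1\in K$ (so $v(p)=\infty$ if $\mathrm{char}K=p>0$). Let $\Gamma$ be the divisible hull of $vK$, embedded in a divisible ordered abelian group $\Lambda$. Let $\nu\colon K[x]\to\Lambda\cup\{\infty\}$ be a valuation extending $v$ which is well-specified, i.e. it is not the case that simultaneously $\nu^{-1}(\infty)=0$, the value group of $\nu$ modulo $\Gamma$ is torsion, and the residue field of $\nu$ is algebraic over that of $v$. For $s\ge0$ let $\partial_s$ be the $s$-th Hasse–Schmidt derivative, defined by $f(x+y)=\sum_{s\ge0}(\partial_sf)y^s$. For nonconstant $f$ with $\nu(f)<\infty$ the level is $\epsilon_\nu(f)=\max\{(\nu(f)-\nu(\partial_sf))/s: s\ge1\}$; $\epsilon_\nu(a)=-\infty$ for $a\in K$. A monic $Q\in K[x]$ is a key polynomial for $\nu$ if $\epsilon_\nu(f)<\epsilon_\nu(Q)$ whenever $\deg f<\deg Q$. For monic $Q$, each $f$ has a unique $Q$-expansion $f=\sum_{i\ge0}f_{Q,i}Q^i$ with $\deg f_{Q,i}<\deg Q$; set $\nu_Q(f)=\min_i\nu(f_{Q,i}Q^i)$, $S_Q(f)=\{i:\nu(f_{Q,i}Q^i)=\nu_Q(f)\}$,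 $\deg_Qf=\max S_Q(f)$. Fix $m\ge1$ such that the set $\Psi_m$ of key polynomials of degree $m$ for $\nu$ is nonempty and has no element of maximal $\nu$-value. Let $\mathcal Q\subseteq\Psi_m$ be well-ordered by $Q<R\iff\nu(Q)<\nu(R)$ and cofinal in $\Psi_m$ for $\nu$-values; write $\gamma_Q=\nu(Q)$. As in the paper, all values $\nu_Q(f)$ ($f\ne0$) lie in $\Gamma$. "For all $Q$ large enough" means for all $Q$ in a final segment of $\mathcal Q$; a family indexed by $\mathcal Q$ is ultimately constant if it is constant on a final segment. $f$ is $\mathcal Q$-stable if $\nu_Q(f)=\nu(f)$ for all $Q$ large enough, $\mathcal Q$-unstable otherwise. Assume unstable polynomials exist; limit key polynomials are the monic $\mathcal Q$-unstable polynomials of minimal degree, forming $\mathrm{KP}_\infty(\mathcal Q)$. For each $f$, $\deg_Qf$ is ultimately constant; for $f\in\mathrm{KP}_\infty(\mathcal Q)$ its ultimate value $d$ (independent of $f$) is the defect of $\mathcal Q$. Fix $F\in\mathrm{KP}_\infty(\mathcal Q)$, $D=\lfloor\deg F/m\rfloor$, $F=\sum_{\ell=0}^DF_{Q,\ell}Q^\ell$, $\beta_{Q,\ell}=\nu(F_{Q,\ell})\in\Gamma\cup\{\infty\}$. Let $\delta^L$ be the smallest initial segment of $\Gamma$ containing $\{\nu_Q(F):Q\in\mathcal Q\}$; write $x>\delta^L$ if $x\in(\Gamma\setminus\delta^L)\cup\{\infty\}$. Let $J$ be the set of $\ell\in\{0,\dots,D\}$ with $\beta_{Q,\ell}+\ell\gamma_Q>\delta^L$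 for all $Q$ large enough, $B=\{0,\dots,D\}\setminus J$, and $B^{ct}$ the set of $\ell\in B$ for which $(\beta_{Q,\ell})_Q$ is ultimately constant. A cut $\eta=(\eta^L,\eta^R)$ of $\Gamma$ is vertically bounded if for every $x\in\eta^L$ and rational $q>1$ there is $y\in\eta^L$ with $q(y-x)>z-x$ for all $z\in\eta^L$; its invariance group is $\{h\in\Gamma:h+\eta^L=\eta^L\}$. Let $\gamma_{\mathcal Q}$ be the cut whose lower set is the smallest initial segment of $\Gamma$ containing $\{\gamma_Q\}$; $\mathcal Q$ is vertically unbounded if $\gamma_{\mathcal Q}$ is not vertically bounded; $H$ is the invariance group of $\gamma_{\mathcal Q}$. *)

theory Defs
  imports "HOL-Computational_Algebra.Polynomial" "HOL-Library.Extended"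
begin

(* Values of the valuation nu : K[x] -> Lambda \<union> {\<infinity>} are modelled in 'g extended,
   using only Fin _ and Pinf (= \<infinity>).  'g is the ordered group Lambda. *)

definition nmul :: "nat \<Rightarrow> 'g::ab_group_add \<Rightarrow> 'g" where
  "nmul n x = (((+) x) ^^ n) 0"

definition divisible_group :: "'g::linordered_ab_group_add itself \<Rightarrow> bool" where
  "divisible_group _ \<longleftrightarrow> (\<forall>(x::'g) (n::nat). n > 0 \<longrightarrow> (\<exists>y. nmul n y = x))"

(* x / n in a divisible torsion-free group *)
definition gdiv :: "nat \<Rightarrow> 'g::ab_group_add \<Rightarrow> 'g" where
  "gdiv n x = (THE y. nmul n y = x)"

fun the_fin :: "'g extended \<Rightarrow> 'g" where
  "the_fin (Fin x) = x"
| "the_fin _ = undefined"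

definition is_valuation :: "('k::field poly \<Rightarrow> 'g::linordered_ab_group_add extended) \<Rightarrow> bool" where
  "is_valuation \<nu> \<longleftrightarrow>
     \<nu> 0 = Pinf \<and> \<nu> 1 = Fin 0 \<and> (\<forall>f. \<nu> f \<noteq> Minf) \<and>
     (\<forall>f g. \<nu> (f * g) = \<nu> f + \<nu> g) \<and>
     (\<forall>f g. min (\<nu> f) (\<nu> g) \<le> \<nu> (f + g))"

definition vval :: "('k::field poly \<Rightarrow> 'g extended) \<Rightarrow> 'k \<Rightarrow> 'g extended" where
  "vval \<nu> a = \<nu> [:a:]"

definition valgrpK :: "('k::field poly \<Rightarrow> 'g::ab_group_add extended) \<Rightarrow> 'g set" where
  "valgrpK \<nu> = {g. \<exists>a. a \<noteq> 0 \<and> vval \<nu> a = Fin g}"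

definition Gam :: "('k::field poly \<Rightarrow> 'g::ab_group_add extended) \<Rightarrow> 'g set" where
  "Gam \<nu> = {x. \<exists>n>0. nmul n x \<in> valgrpK \<nu>}"

definition resid_char :: "('k::field poly \<Rightarrow> 'g::linordered_ab_group_add extended) \<Rightarrow> nat" where
  "resid_char \<nu> = (if \<exists>n>0. vval \<nu> (of_nat n) > Fin 0
                   then (LEAST n. n > 0 \<and> vval \<nu> (of_nat n) > Fin 0) else 0)"

definition char_exp :: "('k::field poly \<Rightarrow> 'g::linordered_ab_group_add extended) \<Rightarrow> nat" where
  "char_exp \<nu> = (if resid_char \<nu> = 0 then 1 else resid_char \<nu>)"

(* the residue field of nu is algebraic over that of v: every residue class of f/g
   (nu g finite, nu f >= nu g) is a root of a monic polynomial with coefficients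
   in the residue field of v (lifted to c_i with v(c_i) >= 0) *)
definition residue_algebraic :: "('k::field poly \<Rightarrow> 'g::linordered_ab_group_add extended) \<Rightarrow> bool" where
  "residue_algebraic \<nu> \<longleftrightarrow>
     (\<forall>f g b. \<nu> g = Fin b \<longrightarrow> Fin b \<le> \<nu> f \<longrightarrow>
        (\<exists>n>0. \<exists>c :: nat \<Rightarrow> 'k. (\<forall>i<n. Fin 0 \<le> vval \<nu> (c i)) \<and>
            \<nu> (f ^ n + (\<Sum>i<n. [:c i:] * f ^ i * g ^ (n - i))) > Fin (nmul n b)))"

definition well_specified :: "('k::field poly \<Rightarrow> 'g::linordered_ab_group_add extended) \<Rightarrow> bool" where
  "well_specified \<nu> \<longleftrightarrow>
     \<not> ((\<forall>f. \<nu> f = Pinf \<longrightarrow> f = 0) \<and>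
        (\<forall>f g. \<nu> f = Fin g \<longrightarrow> (\<exists>n>0. nmul n g \<in> Gam \<nu>)) \<and>
        residue_algebraic \<nu>)"

definition hasse :: "nat \<Rightarrow> 'k::field poly \<Rightarrow> 'k poly" where
  "hasse s f = (\<Sum>i\<le>degree f. monom (of_nat (i choose s) * coeff f i) (i - s))"

(* level epsilon_nu(f); Minf for constants; Pinf (convention) if nu f = \<infinity> *)
definition level :: "('k::field poly \<Rightarrow> 'g::linordered_ab_group_add extended) \<Rightarrow> 'k poly \<Rightarrow> 'g extended" where
  "level \<nu> f =
     (if degree f = 0 then Minf
      else (case \<nu> f of
              Fin a \<Rightarrow> Max ((\<lambda>s. case \<nu> (hasse s f) of
                                    Fin b \<Rightarrow> Fin (gdiv s (a - b))
                                  | _ \<Rightarrow> Minf) ` {1..degree f})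
            | _ \<Rightarrow> Pinf))"

definition key_poly :: "('k::field poly \<Rightarrow> 'g::linordered_ab_group_add extended) \<Rightarrow> 'k poly \<Rightarrow> bool" where
  "key_poly \<nu> Q \<longleftrightarrow> lead_coeff Q = 1 \<and>
     (\<forall>f. degree f < degree Q \<longrightarrow> level \<nu> f < level \<nu> Q)"

definition Psi :: "('k::field poly \<Rightarrow> 'g::linordered_ab_group_add extended) \<Rightarrow> nat \<Rightarrow> 'k poly set" where
  "Psi \<nu> m = {Q. key_poly \<nu> Q \<and> degree Q = m}"

definition exp_coeff :: "'k::field poly \<Rightarrow> 'k poly \<Rightarrow> nat \<Rightarrow> 'k poly" where
  "exp_coeff Q f i = (f div Q ^ i) mod Q"

definition nuQ :: "('k::field poly \<Rightarrow> 'g::linordered_ab_group_add extended) \<Rightarrow> 'k poly \<Rightarrow> 'k poly \<Rightarrow> 'g extended" where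
  "nuQ \<nu> Q f = Min ((\<lambda>i. \<nu> (exp_coeff Q f i * Q ^ i)) ` {..degree f})"

definition SQ :: "('k::field poly \<Rightarrow> 'g::linordered_ab_group_add extended) \<Rightarrow> 'k poly \<Rightarrow> 'k poly \<Rightarrow> nat set" where
  "SQ \<nu> Q f = {i. i \<le> degree f \<and> \<nu> (exp_coeff Q f i * Q ^ i) = nuQ \<nu> Q f}"

definition degQ :: "('k::field poly \<Rightarrow> 'g::linordered_ab_group_add extended) \<Rightarrow> 'k poly \<Rightarrow> 'k poly \<Rightarrow> nat" where
  "degQ \<nu> Q f = Max (SQ \<nu> Q f)"

definition eventually_Q :: "('k::field poly \<Rightarrow> 'g::linordered_ab_group_add extended) \<Rightarrow> 'k poly set \<Rightarrow> ('k poly \<Rightarrow> bool) \<Rightarrow> bool" where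
  "eventually_Q \<nu> QQ P \<longleftrightarrow> (\<exists>Q0\<in>QQ. \<forall>Q\<in>QQ. \<nu> Q0 \<le> \<nu> Q \<longrightarrow> P Q)"

definition ult_const :: "('k::field poly \<Rightarrow> 'g::linordered_ab_group_add extended) \<Rightarrow> 'k poly set \<Rightarrow> ('k poly \<Rightarrow> 'b) \<Rightarrow> bool" where
  "ult_const \<nu> QQ h \<longleftrightarrow> (\<exists>Q0\<in>QQ. \<forall>Q\<in>QQ. \<nu> Q0 \<le> \<nu> Q \<longrightarrow> h Q = h Q0)"

definition Q_stable :: "('k::field poly \<Rightarrow> 'g::linordered_ab_group_add extended) \<Rightarrow> 'k poly set \<Rightarrow> 'k poly \<Rightarrow> bool" where
  "Q_stable \<nu> QQ f \<longleftrightarrow> eventually_Q \<nu> QQ (\<lambda>Q. nuQ \<nu> Q f = \<nu> f)"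

definition KP_inf :: "('k::field poly \<Rightarrow> 'g::linordered_ab_group_add extended) \<Rightarrow> 'k poly set \<Rightarrow> 'k poly set" where
  "KP_inf \<nu> QQ = {F. lead_coeff F = 1 \<and> \<not> Q_stable \<nu> QQ F \<and>
                     (\<forall>g. \<not> Q_stable \<nu> QQ g \<longrightarrow> degree F \<le> degree g)}"

definition gammaQ :: "('k::field poly \<Rightarrow> 'g::linordered_ab_group_add extended) \<Rightarrow> 'k poly \<Rightarrow> 'g" where
  "gammaQ \<nu> Q = the_fin (\<nu> Q)"

definition deltaL :: "('k::field poly \<Rightarrow> 'g::linordered_ab_group_add extended) \<Rightarrow> 'k poly set \<Rightarrow> 'k poly \<Rightarrow> 'g set" where
  "deltaL \<nu> QQ F = {x \<in> Gam \<nu>. \<exists>Q\<in>QQ. Fin x \<le> nuQ \<nu> Q F}"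

(* x > L, for the lower set L of a cut of Gamma *)
definition above_cut :: "'g set \<Rightarrow> 'g set \<Rightarrow> 'g extended \<Rightarrow> bool" where
  "above_cut G L x \<longleftrightarrow> x = Pinf \<or> (\<exists>y. x = Fin y \<and> y \<in> G \<and> y \<notin> L)"

definition Jset :: "('k::field poly \<Rightarrow> 'g::linordered_ab_group_add extended) \<Rightarrow> 'k poly set \<Rightarrow> nat \<Rightarrow> 'k poly \<Rightarrow> nat set" where
  "Jset \<nu> QQ m F = {l. l \<le> degree F div m \<and>
      eventually_Q \<nu> QQ (\<lambda>Q. above_cut (Gam \<nu>) (deltaL \<nu> QQ F)
          (\<nu> (exp_coeff Q F l) + Fin (nmul l (gammaQ \<nu> Q))))}"

definition Bset :: "('k::field poly \<Rightarrow> 'g::linordered_ab_group_add extended) \<Rightarrow> 'k poly set \<Rightarrow> nat \<Rightarrow> 'k poly \<Rightarrow> nat set" where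
  "Bset \<nu> QQ m F = {0..degree F div m} - Jset \<nu> QQ m F"

definition Bct :: "('k::field poly \<Rightarrow> 'g::linordered_ab_group_add extended) \<Rightarrow> 'k poly set \<Rightarrow> nat \<Rightarrow> 'k poly \<Rightarrow> nat set" where
  "Bct \<nu> QQ m F = {l \<in> Bset \<nu> QQ m F. ult_const \<nu> QQ (\<lambda>Q. \<nu> (exp_coeff Q F l))}"

definition vertically_bounded :: "'g::linordered_ab_group_add set \<Rightarrow> bool" where
  "vertically_bounded L \<longleftrightarrow>
     (\<forall>x\<in>L. \<forall>a b :: nat. 0 < b \<and> b < a \<longrightarrow>
        (\<exists>y\<in>L. \<forall>z\<in>L. gdiv b (nmul a (y - x)) > z - x))"

definition invariance_group :: "'g::ab_group_add set \<Rightarrow> 'g set \<Rightarrow> 'g set" where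
  "invariance_group G L = {h \<in> G. (\<lambda>x. h + x) ` L = L}"

definition gammaQQ_lower :: "('k::field poly \<Rightarrow> 'g::linordered_ab_group_add extended) \<Rightarrow> 'k poly set \<Rightarrow> 'g set" where
  "gammaQQ_lower \<nu> QQ = {x \<in> Gam \<nu>. \<exists>Q\<in>QQ. x \<le> gammaQ \<nu> Q}"

end

theory Submission
  imports Defs
begin

text \<open>
  For \<open>m = 1\<close> the elements of \<open>\<Q>\<close> are \<open>x - a\<close>, and \<open>F\<^sub>Q\<^sub>,\<^sub>l = (\<partial>\<^sub>l F)(a)\<close>. For \<open>l \<ge> 1\<close> the
  polynomial \<open>\<partial>\<^sub>l F\<close> has smaller degree than \<open>F\<close>, hence is stable, so \<open>\<beta>\<^sub>Q\<^sub>,\<^sub>l\<close> is ultimately a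
  constant \<open>\<beta>\<^sub>l\<close>. Since \<open>\<partial>\<^sub>k \<partial>\<^sub>l F\<close> is a binomial multiple of \<open>\<partial>\<^sub>k\<^sub>+\<^sub>l F\<close>, stability gives
  \<open>\<beta>\<^sub>l \<le> c + \<beta>\<^sub>k\<^sub>+\<^sub>l + k \<gamma>\<^sub>Q\<close> where \<open>c\<close> is a multiple of \<open>v(p)\<close>, and adding such a \<open>c\<close> does not
  leave the lower cut of the \<open>\<gamma>\<^sub>Q\<close>. Taking \<open>l = 1\<close>, the linear term eventually dominates all
  higher ones, so \<open>\<nu>\<^sub>Q(F) = \<beta>\<^sub>1 + \<gamma>\<^sub>Q\<close> by instability of \<open>F\<close>, and \<open>d = 1\<close>. The leading term lies in
  \<open>B\<close> by minimality of the degree of \<open>F\<close>, and taking \<open>k = 1\<close> carries this down to all \<open>l \<ge> 1\<close>.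
  Finally, \<open>0\<close> is excluded because \<open>\<nu>\<^sub>Q(F)\<close> is strictly increasing in \<open>Q\<close>.
\<close>

section \<open>Multiples in an ordered abelian group\<close>

lemma nmul_0 [simp]: "nmul 0 x = 0"
  by (simp add: nmul_def)

lemma nmul_Suc [simp]: "nmul (Suc n) x = x + nmul n x"
  by (simp add: nmul_def)

lemma nmul_nonneg: "0 \<le> x \<Longrightarrow> 0 \<le> nmul n (x::'g::linordered_ab_group_add)"
  by (induction n) simp_all

lemma nmul_mono: "x \<le> y \<Longrightarrow> nmul n x \<le> nmul n (y::'g::linordered_ab_group_add)"
  by (induction n) (simp_all add: add_mono)

lemma nmul_strict_mono: "n > 0 \<Longrightarrow> x < y \<Longrightarrow> nmul n x < nmul n (y::'g::linordered_ab_group_add)"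
  by (induction n) (auto simp: add_less_le_mono less_imp_le nmul_mono)

section \<open>Hasse-Schmidt derivatives\<close>

lemma coeff_hasse: "coeff (hasse s f) n = of_nat ((n + s) choose s) * coeff f (n + s)"
proof -
  have "coeff (hasse s f) n
      = (\<Sum>i\<le>degree f. if i - s = n then of_nat (i choose s) * coeff f i else 0)"
    by (simp add: hasse_def coeff_sum)
  \<comment> \<open>Natural subtraction truncates, so indices \<open>i < s\<close> also satisfy
    \<open>i - s = n\<close> when \<open>n = 0\<close>; their binomial coefficients vanish.\<close>
  also have "\<dots> = (\<Sum>i\<le>degree f. if i = n + s then of_nat (i choose s) * coeff f i else 0)"
    by (rule sum.cong) (auto simp: binomial_eq_0)
  also have "\<dots> = of_nat ((n + s) choose s) * coeff f (n + s)"
    by (auto simp: coeff_eq_0)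
  finally show ?thesis .
qed

lemma hasse_0 [simp]: "hasse 0 f = f"
  by (rule poly_eqI) (simp add: coeff_hasse)

lemma hasse_of_zero [simp]: "hasse s 0 = 0"
  by (rule poly_eqI) (simp add: coeff_hasse)

lemma hasse_diff: "hasse s (f - g) = hasse s f - hasse s g"
  by (rule poly_eqI) (simp add: coeff_hasse algebra_simps)

text \<open>Leibniz rule for the factor x, which on coefficients is Pascal's rule. It drives the
  induction in \<open>poly_hasse_eq_coeff\<close>.\<close>

lemma hasse_pCons: "hasse (Suc s) (pCons c f) = hasse s f + pCons 0 (hasse (Suc s) f)"
proof (rule poly_eqI)
  fix n
  show "coeff (hasse (Suc s) (pCons c f)) n = coeff (hasse s f + pCons 0 (hasse (Suc s) f)) n"
    by (cases n) (simp_all add: coeff_hasse algebra_simps)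
qed

text \<open>On coefficients this is the identity for choosing nested subsets, which rewrites a
  product of two binomials. The integer factor is the sole source of multiples of v(p) later
  on.\<close>

lemma hasse_hasse: "hasse k (hasse l f) = smult (of_nat ((k + l) choose k)) (hasse (k + l) f)"
proof (rule poly_eqI)
  fix n
  have "((n + k + l) choose l) * ((n + k) choose k) = ((n + k + l) choose (k + l)) * ((k + l) choose k)"
    using choose_mult_lemma[of k n l] by (simp add: ac_simps binomial_symmetric[of k "k + l"])
  then have "(of_nat ((n + k) choose k) * of_nat ((n + k + l) choose l) :: 'a)
      = of_nat ((k + l) choose k) * of_nat ((n + (k + l)) choose (k + l))"
    by (metis of_nat_mult mult.commute add.assoc)
  then show "coeff (hasse k (hasse l f)) n = coeff (smult (of_nat ((k + l) choose k)) (hasse (k + l) f)) n"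
    by (simp add: coeff_hasse add.assoc mult.assoc[symmetric])
qed

lemma degree_hasse_less:
  assumes "0 < s" "0 < degree f"
  shows "degree (hasse s f) < degree f"
proof -
  have "degree (hasse s f) \<le> degree f - 1"
    by (rule degree_le) (use assms in \<open>auto simp: coeff_hasse coeff_eq_0\<close>)
  with assms show ?thesis by simp
qed

lemma hasse_degree: "hasse (degree f) f = [:lead_coeff f:]"
  by (rule poly_eqI) (auto simp: coeff_hasse coeff_pCons coeff_eq_0 split: nat.split)

lemma hasse_1_linear_power: "hasse 1 ([:- a, 1:] ^ n) = smult (of_nat n) ([:- a, 1:] ^ (n - 1))"
proof -
  have "hasse 1 f = pderiv f" for f :: "'a poly"
    by (rule poly_eqI) (simp add: coeff_hasse coeff_pderiv)
  then show ?thesis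
    by (cases n) (simp_all add: pderiv_power_Suc pderiv_pCons del: power_Suc)
qed

section \<open>Taylor expansions and expansions in powers of a linear polynomial\<close>

lemma poly_hasse_eq_coeff: "poly (hasse s f) a = coeff (pcompose f [:a, 1:]) s"
proof (induction f arbitrary: s)
  case 0
  then show ?case by simp
next
  case (pCons c f)
  show ?case
  proof (cases s)
    case 0
    then show ?thesis using pCons(2)[of 0] by (simp add: pcompose_pCons)
  next
    case (Suc t)
    \<comment> \<open>Multiplication of g by x + a sends its coefficients to a*g_s + g_(s-1), which
      matches the two summands of \<open>hasse_pCons\<close> evaluated at a.\<close>
    then show ?thesis using pCons(2)[of t] pCons(2)[of s]
      by (simp add: hasse_pCons pcompose_pCons)
  qed
qed

lemma mod_linear: "f mod [:- a, 1:] = [:poly f (a::'k::field):]"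
proof -
  have "f mod [:- a, 1:] = ([:- a, 1:] * synthetic_div f a + [:poly f a:]) mod [:- a, 1:]"
    by (simp only: synthetic_div_correct')
  also have "\<dots> = [:poly f a:]"
    by (simp add: mod_poly_less del: mult_pCons_left)
  finally show ?thesis .
qed

text \<open>After the substitution of x + a for x, division by x - a becomes a shift of
  coefficients, so coefficient \<open>Suc i\<close> of f is coefficient i of the quotient.\<close>

lemma exp_coeff_linear: "exp_coeff [:- a, 1:] f i = [:poly (hasse i f) a:]"
proof (induction i arbitrary: f)
  case 0
  show ?case by (simp add: exp_coeff_def mod_linear)
next
  case (Suc i)
  define q where "q = f div [:-a, 1:]"
  have "f = [:-a, 1:] * q + [:poly f a:]"
    using div_mult_mod_eq[of f "[:-a, 1:]"] mod_linear[of f a] unfolding q_def by (simp add: ac_simps)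
  then have "pcompose f [:a,1:] = pcompose [:-a, 1:] [:a,1:] * pcompose q [:a,1:] + [:poly f a:]"
    by (metis pcompose_add pcompose_mult pcompose_const)
  then have "coeff (pcompose f [:a,1:]) (Suc i) = coeff (pcompose q [:a,1:]) i"
    by (simp add: pcompose_pCons)
  moreover have "exp_coeff [:-a, 1:] f (Suc i) = exp_coeff [:-a, 1:] q i"
    by (simp add: exp_coeff_def q_def poly_div_mult_right del: mult_pCons_left)
  ultimately show ?case using Suc[of q] by (simp add: poly_hasse_eq_coeff)
qed

text \<open>Substitute x + a for x and then x - a for x; the coefficients in between are the Hasse
  derivatives at a.\<close>

lemma taylor_expansion: "f = (\<Sum>i\<le>degree f. [:poly (hasse i f) a:] * [:- a, 1:] ^ i)"
proof -
  have "f = pcompose (pcompose f [:a, 1:]) [:- a, 1:]"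
    by (simp add: pcompose_assoc[symmetric] pcompose_pCons)
  also have "\<dots> = (\<Sum>i\<le>degree f. [:poly (hasse i f) a:] * [:- a, 1:] ^ i)"
    by (simp add: pcompose_altdef[of "pcompose f [:a, 1:]"]
        poly_altdef[of "map_poly _ _"] poly_hasse_eq_coeff degree_map_poly coeff_map_poly degree_pcompose)
  finally show ?thesis .
qed

section \<open>Valuations on the polynomial ring\<close>

locale poly_valuation =
  fixes \<nu> :: "'k::field poly \<Rightarrow> 'g::linordered_ab_group_add extended"
  assumes val: "is_valuation \<nu>"
begin

lemma nu_0 [simp]: "\<nu> 0 = Pinf"
  and nu_1 [simp]: "\<nu> 1 = Fin 0"
  and nu_not_Minf [simp]: "\<nu> f \<noteq> Minf"
  and nu_mult: "\<nu> (f * g) = \<nu> f + \<nu> g"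
  and nu_add_ge: "min (\<nu> f) (\<nu> g) \<le> \<nu> (f + g)"
  using val by (auto simp: is_valuation_def)

lemma nu_const_finite:
  assumes "c \<noteq> 0"
  obtains g where "\<nu> [:c:] = Fin g"
proof -
  have "\<nu> [:c:] + \<nu> [:1 / c:] = \<nu> 1"
    using assms by (simp add: nu_mult[symmetric] one_pCons)
  then show ?thesis
    using that by (cases "\<nu> [:c:]"; cases "\<nu> [:1 / c:]") auto
qed

text \<open>Twice the value of -1 is the value of 1, that is 0, and an ordered group has no
  torsion.\<close>

lemma nu_minus [simp]: "\<nu> (- f) = \<nu> f"
proof -
  have "\<nu> (-1) + \<nu> (-1) = Fin 0"
    by (simp add: nu_mult[symmetric])
  then have "\<nu> (-1) = Fin 0"
    by (cases "\<nu> (-1)") (auto simp: double_zero)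
  then show ?thesis
    using nu_mult[of "-1" f] by (cases "\<nu> f") auto
qed

lemma nu_add_eq_left:
  assumes "\<nu> f < \<nu> g"
  shows "\<nu> (f + g) = \<nu> f"
proof (rule antisym)
  show "\<nu> f \<le> \<nu> (f + g)"
    using nu_add_ge[of f g] assms by (simp add: min_absorb1)
  have "min (\<nu> (f + g)) (\<nu> g) \<le> \<nu> f"
    using nu_add_ge[of "f + g" "- g"] by simp
  then show "\<nu> (f + g) \<le> \<nu> f"
    using assms by (auto simp: min_def split: if_splits)
qed

lemma nu_sum_ge:
  assumes "\<And>i. i \<in> I \<Longrightarrow> t \<le> \<nu> (f i)"
  shows "t \<le> \<nu> (\<Sum>i\<in>I. f i)"
  using assms
proof (induction I rule: infinite_finite_induct)
  case (insert x F)
  then have "t \<le> min (\<nu> (f x)) (\<nu> (\<Sum>i\<in>F. f i))" by simp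
  also have "\<dots> \<le> \<nu> (f x + (\<Sum>i\<in>F. f i))" by (rule nu_add_ge)
  finally show ?case using insert by simp
qed simp_all

lemma nu_sum_greater:
  assumes "\<And>i. i \<in> I \<Longrightarrow> Fin y < \<nu> (f i)"
  shows "Fin y < \<nu> (\<Sum>i\<in>I. f i)"
  using assms
proof (induction I rule: infinite_finite_induct)
  case (insert x F)
  then have "Fin y < min (\<nu> (f x)) (\<nu> (\<Sum>i\<in>F. f i))" by simp
  also have "\<dots> \<le> \<nu> (f x + (\<Sum>i\<in>F. f i))" by (rule nu_add_ge)
  finally show ?case using insert by simp
qed simp_all

lemma nu_power: "\<nu> f = Fin g \<Longrightarrow> \<nu> (f ^ n) = Fin (nmul n g)"
  by (induction n) (simp_all add: nu_mult)

lemma nu_of_nat_nonneg: "Fin 0 \<le> \<nu> [:of_nat n:]"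
proof (induction n)
  case (Suc n)
  then have "Fin 0 \<le> min (\<nu> 1) (\<nu> [:of_nat n:])" by simp
  also have "\<dots> \<le> \<nu> (1 + [:of_nat n:])" by (rule nu_add_ge)
  finally show ?case by (simp add: one_pCons)
qed simp

section \<open>Truncations at linear polynomials and change of centre\<close>

lemma nu_diff_gap:
  assumes "\<nu> [:- a, 1:] = Fin g" "Fin g < \<nu> [:- b, 1:]"
  shows "\<nu> [:b - a:] = Fin g"
proof -
  have "[:b - a:] = [:- a, 1:] + - [:- b, 1:]" by simp
  then show ?thesis
    using nu_add_eq_left[of "[:- a, 1:]" "- [:- b, 1:]"] assms by (simp del: minus_pCons)
qed

lemma nuQ_linear_le: "nuQ \<nu> [:- a, 1:] f \<le> \<nu> ([:poly (hasse i f) a:] * [:- a, 1:] ^ i)"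
proof (cases "i \<le> degree f")
  case True
  then show ?thesis
    unfolding nuQ_def exp_coeff_linear by (intro Min_le) auto
next
  case False
  \<comment> \<open>Beyond the degree the term is zero and has infinite value, so the bound holds
    for every index.\<close>
  then have "hasse i f = 0"
    by (intro poly_eqI) (simp add: coeff_hasse coeff_eq_0)
  then show ?thesis by simp
qed

lemma nuQ_linear_ge_iff:
  "t \<le> nuQ \<nu> [:- a, 1:] f \<longleftrightarrow> (\<forall>i\<le>degree f. t \<le> \<nu> ([:poly (hasse i f) a:] * [:- a, 1:] ^ i))"
  unfolding nuQ_def exp_coeff_linear by (subst Min_ge_iff) auto

lemma nuQ_linear_greater_iff:
  "t < nuQ \<nu> [:- a, 1:] f \<longleftrightarrow> (\<forall>i\<le>degree f. t < \<nu> ([:poly (hasse i f) a:] * [:- a, 1:] ^ i))"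
  unfolding nuQ_def exp_coeff_linear by (subst Min_gr_iff) auto

lemma nuQ_linear_le_nu: "nuQ \<nu> [:- a, 1:] f \<le> \<nu> f"
  by (subst (2) taylor_expansion[of f a]) (rule nu_sum_ge, rule nuQ_linear_le)

text \<open>The leading coefficient is a nonzero constant, so the term of top degree has finite
  value and bounds the minimum.\<close>

lemma nuQ_linear_finite:
  assumes "f \<noteq> 0" "\<nu> [:- a, 1:] = Fin g"
  obtains y where "nuQ \<nu> [:- a, 1:] f = Fin y"
proof -
  obtain c where c: "\<nu> [:lead_coeff f:] = Fin c"
    using nu_const_finite assms(1) by (metis leading_coeff_0_iff)
  have "nuQ \<nu> [:- a, 1:] f \<le> Fin (c + nmul (degree f) g)"
    using nuQ_linear_le[of a f "degree f"] c nu_power[OF assms(2)]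
    by (simp add: nu_mult hasse_degree del: mult_pCons_left)
  moreover have "Minf < nuQ \<nu> [:- a, 1:] f"
  proof -
    have "Minf < \<nu> h" for h using nu_not_Minf[of h] by (cases "\<nu> h") simp_all
    then show ?thesis by (simp add: nuQ_linear_greater_iff)
  qed
  ultimately show ?thesis
    using that by (cases "nuQ \<nu> [:- a, 1:] f") auto
qed

text \<open>Here b is a better centre than a, so b - a has the same value as x - a. Expanding the
  l-th derivative at a and evaluating at b therefore gives terms whose values are those of the
  expansion of f at a, up to integer factors that can only raise them. For positive l the bound
  becomes strict when b - a is replaced by x - b, which has larger value.\<close>

lemma nu_taylor_term_shift:
  assumes a: "\<nu> [:- a, 1:] = Fin g" and b: "\<nu> [:- b, 1:] = Fin g'" and "g < g'"
    and y: "Fin y \<le> nuQ \<nu> [:- a, 1:] f"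
  shows "Fin y \<le> \<nu> ([:poly (hasse l f) b:] * [:b - a:] ^ l)" (is ?A)
    and "0 < l \<Longrightarrow> Fin y < \<nu> ([:poly (hasse l f) b:] * [:- b, 1:] ^ l)"
proof -
  have gap: "\<nu> [:b - a:] = Fin g"
    using nu_diff_gap a b \<open>g < g'\<close> by simp
  define c where "c k = of_nat ((k + l) choose k) * poly (hasse (k + l) f) a" for k
  have "poly (hasse l f) b = (\<Sum>k\<le>degree (hasse l f). c k * (b - a) ^ k)"
    using arg_cong[OF taylor_expansion[of "hasse l f" a], of "\<lambda>q. poly q b"]
    by (simp add: poly_sum hasse_hasse c_def)
  then have "[:poly (hasse l f) b:] = (\<Sum>k\<le>degree (hasse l f). [:c k:] * [:b - a:] ^ k)"
    by (simp add: sum_to_poly poly_const_pow mult.commute)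
  then have eq: "[:poly (hasse l f) b:] * [:b - a:] ^ l
      = (\<Sum>k\<le>degree (hasse l f). [:c k:] * [:b - a:] ^ (k + l))"
    by (simp add: sum_distrib_right power_add mult.assoc del: mult_pCons_left)
  have "Fin y \<le> \<nu> ([:c k:] * [:b - a:] ^ (k + l))" for k
  proof -
    have "[:c k:] = [:of_nat ((k + l) choose k):] * [:poly (hasse (k + l) f) a:]"
      by (simp add: c_def)
    then have "\<nu> ([:c k:] * [:b - a:] ^ (k + l)) = \<nu> [:of_nat ((k + l) choose k):]
         + \<nu> ([:poly (hasse (k + l) f) a:] * [:- a, 1:] ^ (k + l))"
      by (simp only: nu_mult nu_power[OF gap] nu_power[OF a] add.assoc)
    moreover have "Fin 0 + Fin y \<le> \<dots>"
      by (intro add_mono nu_of_nat_nonneg order.trans[OF y nuQ_linear_le])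
    ultimately show ?thesis by simp
  qed
  then show A: ?A
    unfolding eq by (intro nu_sum_ge)
  assume "0 < l"
  show "Fin y < \<nu> ([:poly (hasse l f) b:] * [:- b, 1:] ^ l)"
  proof (cases "poly (hasse l f) b = 0")
    case False
    then obtain e where e: "\<nu> [:poly (hasse l f) b:] = Fin e" by (rule nu_const_finite)
    have "y \<le> e + nmul l g"
      using A by (simp only: nu_mult nu_power[OF gap] e) simp
    also have "\<dots> < e + nmul l g'"
      using nmul_strict_mono[OF \<open>0 < l\<close> \<open>g < g'\<close>] by simp
    finally show ?thesis
      by (simp only: nu_mult nu_power[OF b] e) simp
  qed simp
qed

text \<open>All nonconstant terms at the better centre b exceed the truncated value at a, so f
  agrees with the constant f(b) up to an error of larger value.\<close>

lemma taylor_remainder_greater: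
  assumes "\<nu> [:- a, 1:] = Fin g" "\<nu> [:- b, 1:] = Fin g'" "g < g'"
    and "nuQ \<nu> [:- a, 1:] f = Fin y"
  shows "\<exists>r. f = [:poly f b:] + r \<and> Fin y < \<nu> r"
proof -
  define r where "r = (\<Sum>i\<in>{1..degree f}. [:poly (hasse i f) b:] * [:- b, 1:] ^ i)"
  have "f = [:poly f b:] + r"
    using taylor_expansion[of f b] unfolding r_def
    by (simp add: atMost_atLeast0 sum.atLeast_Suc_atMost)
  moreover have "Fin y < \<nu> r"
    unfolding r_def using assms by (intro nu_sum_greater nu_taylor_term_shift(2)) auto
  ultimately show ?thesis by blast
qed

text \<open>The error in \<open>taylor_remainder_greater\<close> exceeds the value of f, so f(b) has
  that value and is a minimal term at b.\<close>

lemma stable_step: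
  assumes "\<nu> [:- a, 1:] = Fin g" "\<nu> [:- b, 1:] = Fin g'" "g < g'"
    and st: "nuQ \<nu> [:- a, 1:] f = \<nu> f"
  shows "\<nu> [:poly f b:] = \<nu> f" "nuQ \<nu> [:- b, 1:] f = \<nu> f"
proof -
  have "\<nu> [:poly f b:] = \<nu> f \<and> nuQ \<nu> [:- b, 1:] f = \<nu> f"
  proof (cases "f = 0")
    case True
    then show ?thesis by (simp add: nuQ_def exp_coeff_linear)
  next
    case False
    then obtain y where y: "nuQ \<nu> [:- a, 1:] f = Fin y"
      using nuQ_linear_finite assms(1) by metis
    then obtain r where r: "f = [:poly f b:] + r" "Fin y < \<nu> r"
      using taylor_remainder_greater assms by metis
    have "\<nu> f < \<nu> (- r)" using r y st by simp
    then have 1: "\<nu> [:poly f b:] = \<nu> f"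
      using nu_add_eq_left[of f "- r"] r(1) by (metis add_diff_cancel_right' diff_conv_add_uminus)
    have "Fin y \<le> nuQ \<nu> [:- b, 1:] f"
      unfolding nuQ_linear_ge_iff
    proof (intro allI impI)
      fix i assume "i \<le> degree f"
      show "Fin y \<le> \<nu> ([:poly (hasse i f) b:] * [:- b, 1:] ^ i)"
      proof (cases "i = 0")
        case True
        then show ?thesis using 1 y st by simp
      next
        case False
        then show ?thesis
          using nu_taylor_term_shift(2)[OF assms(1-3), of y f i] y by (simp del: mult_pCons_left)
      qed
    qed
    then show ?thesis using 1 nuQ_linear_le_nu[of b f] y st by simp
  qed
  then show "\<nu> [:poly f b:] = \<nu> f" "nuQ \<nu> [:- b, 1:] f = \<nu> f" by auto
qed

text \<open>Both f and the error have value above the truncation at a, hence so does f(b); the other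
  terms at b exceed it anyway.\<close>

lemma unstable_step:
  assumes "\<nu> [:- a, 1:] = Fin g" "\<nu> [:- b, 1:] = Fin g'" "g < g'"
    and unst: "nuQ \<nu> [:- a, 1:] f < \<nu> f"
  shows "nuQ \<nu> [:- a, 1:] f < nuQ \<nu> [:- b, 1:] f"
proof -
  have "f \<noteq> 0" using unst by (auto simp: nuQ_def exp_coeff_linear)
  then obtain y where y: "nuQ \<nu> [:- a, 1:] f = Fin y"
    using nuQ_linear_finite assms(1) by metis
  then obtain r where r: "f = [:poly f b:] + r" "Fin y < \<nu> r"
    using taylor_remainder_greater assms by metis
  have "min (\<nu> f) (\<nu> (- r)) \<le> \<nu> (f + - r)" by (rule nu_add_ge)
  also have "f + - r = [:poly f b:]" using r(1) by (metis add_diff_cancel_right' diff_conv_add_uminus)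
  finally have 1: "Fin y < \<nu> [:poly f b:]"
    using r(2) unst y by (auto simp: min_def split: if_splits)
  show ?thesis
    unfolding nuQ_linear_greater_iff y
  proof (intro allI impI)
    fix i assume "i \<le> degree f"
    show "Fin y < \<nu> ([:poly (hasse i f) b:] * [:- b, 1:] ^ i)"
    proof (cases "i = 0")
      case True
      then show ?thesis using 1 by simp
    next
      case False
      then show ?thesis
        using nu_taylor_term_shift(2)[OF assms(1-3), of y f i] y by (simp del: mult_pCons_left)
    qed
  qed
qed

text \<open>An integer of positive value is divisible by the residue characteristic; splitting off
  one such factor leaves a smaller integer, and the factors are counted by j.\<close>

lemma nu_of_nat_eq:
  assumes h: "vval \<nu> (of_nat (char_exp \<nu>)) = Fin h" and "0 < n"
  shows "\<exists>j. \<nu> [:of_nat n:] = Fin (nmul j h)"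
  using \<open>0 < n\<close>
proof (induction n rule: less_induct)
  case (less n)
  show ?case
  proof (cases "Fin 0 < \<nu> [:of_nat n:]")
    case False
    then have "\<nu> [:of_nat n:] = Fin (nmul 0 h)"
      using nu_of_nat_nonneg[of n] by (simp add: order.antisym not_less)
    then show ?thesis ..
  next
    case True
    let ?P = "\<lambda>n. 0 < n \<and> Fin 0 < vval \<nu> (of_nat n)"
    have ex: "?P n" using True less.prems by (simp add: vval_def)
    define p where "p = (LEAST n. ?P n)"
    have p: "?P p" unfolding p_def using ex by (rule LeastI)
    have "resid_char \<nu> = p" using ex unfolding resid_char_def p_def by meson
    then have hp: "\<nu> [:of_nat p:] = Fin h"
      using p h by (simp add: char_exp_def vval_def)
    \<comment> \<open>Otherwise the remainder, as a difference of two elements of positive value,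
      would be a positive integer below p of positive value, against the minimality of p.\<close>
    have "n mod p = 0"
    proof (rule ccontr)
      assume "n mod p \<noteq> 0"
      moreover have "n mod p < p" using p by simp
      ultimately have "\<not> Fin 0 < vval \<nu> (of_nat (n mod p))"
        unfolding p_def using not_less_Least by blast
      moreover have "[:of_nat (n mod p):] = [:of_nat n:] + - ([:of_nat p:] * [:of_nat (n div p):] :: 'k poly)"
      proof -
        have "(of_nat n :: 'k) = of_nat p * of_nat (n div p) + of_nat (n mod p)"
          by (metis mult_div_mod_eq of_nat_add of_nat_mult)
        then show ?thesis by simp
      qed
      moreover have "Fin 0 < \<nu> ([:of_nat p:] * [:of_nat (n div p):])"
        using nu_of_nat_nonneg[of "n div p"] p unfolding nu_mult vval_def
        by (cases "\<nu> [:of_nat p:]"; cases "\<nu> [:of_nat (n div p):]") (auto simp: add_pos_nonneg)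
      ultimately show False
        using True nu_add_ge[of "[:of_nat n:]" "- ([:of_nat p:] * [:of_nat (n div p):])"]
        unfolding nu_minus vval_def by (metis less_le_trans min_less_iff_conj)
    qed
    then obtain q where q: "n = p * q" by auto
    have "p \<noteq> 1" using p by (auto simp: vval_def one_pCons[symmetric])
    then have "q < n" "0 < q" using q p less.prems by auto
    then obtain j where j: "\<nu> [:of_nat q:] = Fin (nmul j h)" using less.IH by blast
    have "\<nu> [:of_nat n:] = \<nu> ([:of_nat p:] * [:of_nat q:])" by (simp add: q mult.commute)
    also have "\<dots> = Fin (nmul (Suc j) h)" unfolding nu_mult hp j by simp
    finally show ?thesis ..
  qed
qed

end

section \<open>Chains of linear polynomials without a largest value\<close>

locale linear_chain = poly_valuation \<nu>
  for \<nu> :: "'k::field poly \<Rightarrow> 'g::linordered_ab_group_add extended" +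
  fixes QQ :: "'k poly set"
  assumes QQ_monic: "Q \<in> QQ \<Longrightarrow> lead_coeff Q = 1"
    and QQ_degree: "Q \<in> QQ \<Longrightarrow> degree Q = 1"
    and QQ_nonempty: "QQ \<noteq> {}"
    and QQ_no_max: "Q \<in> QQ \<Longrightarrow> \<exists>R\<in>QQ. \<nu> Q < \<nu> R"
begin

abbreviation ev :: "('k poly \<Rightarrow> bool) \<Rightarrow> bool" where
  "ev \<equiv> eventually_Q \<nu> QQ"

definition center :: "'k poly \<Rightarrow> 'k" where
  "center Q = - coeff Q 0"

lemma QQ_eq:
  assumes "Q \<in> QQ"
  shows "Q = [:- center Q, 1:]"
proof -
  have "degree Q = 1" "coeff Q 1 = 1"
    using QQ_monic[OF assms] QQ_degree[OF assms] by simp_all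
  then show ?thesis
    by (intro poly_eqI) (auto simp: center_def coeff_pCons coeff_eq_0 split: nat.split)
qed

lemma nu_QQ:
  assumes "Q \<in> QQ"
  shows "\<nu> Q = Fin (gammaQ \<nu> Q)"
  using QQ_no_max[OF assms] nu_not_Minf[of Q] by (cases "\<nu> Q") (auto simp: gammaQ_def)

lemma nu_linear_center: "Q \<in> QQ \<Longrightarrow> \<nu> [:- center Q, 1:] = Fin (gammaQ \<nu> Q)"
  by (simp add: QQ_eq[symmetric] nu_QQ)

lemma exp_coeff_QQ: "Q \<in> QQ \<Longrightarrow> exp_coeff Q f i = [:poly (hasse i f) (center Q):]"
  using exp_coeff_linear[of "center Q" f i] by (simp only: QQ_eq[symmetric])

lemma nu_taylor_term:
  assumes "Q \<in> QQ"
  shows "\<nu> ([:c:] * [:- center Q, 1:] ^ i) = \<nu> [:c:] + Fin (nmul i (gammaQ \<nu> Q))"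
  using nu_power[OF nu_linear_center[OF assms]] by (simp only: nu_mult)

lemma nuQ_le_term:
  assumes "Q \<in> QQ"
  shows "nuQ \<nu> Q f \<le> \<nu> [:poly (hasse i f) (center Q):] + Fin (nmul i (gammaQ \<nu> Q))"
  using nuQ_linear_le[of "center Q" f i] nu_taylor_term[OF assms, of _ i]
  unfolding QQ_eq[OF assms, symmetric] by (simp only:)

lemma nuQ_le_const: "Q \<in> QQ \<Longrightarrow> nuQ \<nu> Q f \<le> \<nu> [:poly f (center Q):]"
  using nuQ_le_term[of Q f 0] by (simp add: zero_extended_def[symmetric])

lemma nu_less_iff: "Q \<in> QQ \<Longrightarrow> R \<in> QQ \<Longrightarrow> \<nu> Q < \<nu> R \<longleftrightarrow> gammaQ \<nu> Q < gammaQ \<nu> R"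
  by (simp add: nu_QQ)

lemma ev_mono: "ev P \<Longrightarrow> (\<And>Q. Q \<in> QQ \<Longrightarrow> P Q \<Longrightarrow> P' Q) \<Longrightarrow> ev P'"
  unfolding eventually_Q_def by blast

lemma ev_conj:
  assumes "ev P" "ev P'"
  shows "ev (\<lambda>Q. P Q \<and> P' Q)"
proof -
  obtain Q0 Q1 where Q0: "Q0 \<in> QQ" "\<And>Q. Q \<in> QQ \<Longrightarrow> \<nu> Q0 \<le> \<nu> Q \<Longrightarrow> P Q"
    and Q1: "Q1 \<in> QQ" "\<And>Q. Q \<in> QQ \<Longrightarrow> \<nu> Q1 \<le> \<nu> Q \<Longrightarrow> P' Q"
    using assms unfolding eventually_Q_def by blast
  define R where "R = (if \<nu> Q0 \<le> \<nu> Q1 then Q1 else Q0)"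
  have "R \<in> QQ" "\<nu> Q0 \<le> \<nu> R" "\<nu> Q1 \<le> \<nu> R"
    using Q0(1) Q1(1) by (auto simp: R_def)
  then show ?thesis
    using Q0(2) Q1(2) unfolding eventually_Q_def by (intro bexI[of _ R]) auto
qed

lemma ev_True: "ev (\<lambda>_. True)"
  unfolding eventually_Q_def using QQ_nonempty by blast

lemma ev_ball:
  assumes "finite I" "\<And>i. i \<in> I \<Longrightarrow> ev (P i)"
  shows "ev (\<lambda>Q. \<forall>i\<in>I. P i Q)"
  using assms
proof (induction I rule: finite_induct)
  case empty
  then show ?case by (simp add: ev_True)
next
  case (insert i I)
  then have "ev (\<lambda>Q. P i Q \<and> (\<forall>i\<in>I. P i Q))" by (intro ev_conj) auto
  then show ?case by simp
qed

lemma ev_ex: "ev P \<Longrightarrow> \<exists>Q\<in>QQ. P Q"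
  unfolding eventually_Q_def by blast

lemma ev_above:
  assumes "Q \<in> QQ"
  shows "ev (\<lambda>R. \<nu> Q < \<nu> R)"
proof -
  obtain R where "R \<in> QQ" "\<nu> Q < \<nu> R" using QQ_no_max assms by blast
  then show ?thesis unfolding eventually_Q_def by (meson less_le_trans)
qed

text \<open>By \<open>stable_step\<close>, equality at a single Q passes to every later one. The
  same step fixes the value at the centre, which is what makes the coefficients of F ultimately
  constant in value.\<close>

lemma stable_ev:
  assumes "Q_stable \<nu> QQ f"
  shows "ev (\<lambda>Q. \<nu> [:poly f (center Q):] = \<nu> f \<and> nuQ \<nu> Q f = \<nu> f)"
proof -
  obtain Q where Q: "Q \<in> QQ" "nuQ \<nu> Q f = \<nu> f"
    using ev_ex assms unfolding Q_stable_def by blast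
  show ?thesis
  proof (rule ev_mono[OF ev_above[OF Q(1)]])
    fix R assume R: "R \<in> QQ" "\<nu> Q < \<nu> R"
    show "\<nu> [:poly f (center R):] = \<nu> f \<and> nuQ \<nu> R f = \<nu> f"
      using stable_step[OF nu_linear_center nu_linear_center, of Q R f] Q R
      by (simp add: nu_less_iff QQ_eq[symmetric])
  qed
qed

text \<open>Equality at one Q would persist at all later ones and make f stable.\<close>

lemma unstable_nuQ_less:
  assumes "\<not> Q_stable \<nu> QQ f" "Q \<in> QQ"
  shows "nuQ \<nu> Q f < \<nu> f"
proof (rule ccontr)
  assume "\<not> nuQ \<nu> Q f < \<nu> f"
  then have Q: "nuQ \<nu> Q f = \<nu> f"
    using nuQ_linear_le_nu[of "center Q" f] QQ_eq[OF assms(2)] by simp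
  have "ev (\<lambda>R. nuQ \<nu> R f = \<nu> f)"
  proof (rule ev_mono[OF ev_above[OF assms(2)]])
    fix R assume R: "R \<in> QQ" "\<nu> Q < \<nu> R"
    show "nuQ \<nu> R f = \<nu> f"
      using stable_step(2)[OF nu_linear_center nu_linear_center, of Q R f] Q R assms(2)
      by (simp add: nu_less_iff QQ_eq[symmetric])
  qed
  with assms(1) show False by (simp add: Q_stable_def)
qed

lemma unstable_nuQ_strict_mono:
  assumes "\<not> Q_stable \<nu> QQ f" "Q \<in> QQ" "R \<in> QQ" "\<nu> Q < \<nu> R"
  shows "nuQ \<nu> Q f < nuQ \<nu> R f"
  using unstable_step[OF nu_linear_center nu_linear_center, of Q R f] unstable_nuQ_less[OF assms(1,2)] assms
  by (simp add: nu_less_iff QQ_eq[symmetric])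

lemma valgrpK_in_Gam: "g \<in> valgrpK \<nu> \<Longrightarrow> g \<in> Gam \<nu>"
  unfolding Gam_def by (auto intro!: exI[of _ 1])

text \<open>The value of Q is that of the difference between its centre and a later centre, hence
  the value of an element of K.\<close>

lemma gammaQ_in_Gam:
  assumes "Q \<in> QQ"
  shows "gammaQ \<nu> Q \<in> Gam \<nu>"
proof (rule valgrpK_in_Gam)
  obtain R where R: "R \<in> QQ" "\<nu> Q < \<nu> R" using QQ_no_max assms by blast
  then have "\<nu> [:center R - center Q:] = Fin (gammaQ \<nu> Q)"
    using nu_diff_gap[OF nu_linear_center[OF assms]] nu_linear_center[OF R(1)] nu_less_iff assms by simp
  moreover from this have "center R - center Q \<noteq> 0"
    by (metis extended.distinct(1) nu_0 pCons_0_0)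
  ultimately show "gammaQ \<nu> Q \<in> valgrpK \<nu>"
    unfolding valgrpK_def vval_def by blast
qed

text \<open>Translation by h maps the lower cut to itself, so each added h is absorbed by passing to
  a later member of the chain.\<close>

lemma invariance_bound:
  assumes h: "h \<in> invariance_group (Gam \<nu>) (gammaQQ_lower \<nu> QQ)" and "Q \<in> QQ"
  shows "\<exists>R\<in>QQ. nmul j h + gammaQ \<nu> Q \<le> gammaQ \<nu> R"
proof (induction j)
  case 0
  then show ?case using assms(2) by auto
next
  case (Suc j)
  then obtain R where R: "R \<in> QQ" "nmul j h + gammaQ \<nu> Q \<le> gammaQ \<nu> R" by blast
  have "gammaQ \<nu> R \<in> gammaQQ_lower \<nu> QQ"
    using R gammaQ_in_Gam by (auto simp: gammaQQ_lower_def)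
  then have "h + gammaQ \<nu> R \<in> gammaQQ_lower \<nu> QQ"
    using h by (auto simp: invariance_group_def)
  then obtain R' where "R' \<in> QQ" "h + gammaQ \<nu> R \<le> gammaQ \<nu> R'"
    by (auto simp: gammaQQ_lower_def)
  moreover have "nmul (Suc j) h + gammaQ \<nu> Q \<le> h + gammaQ \<nu> R"
    using R by (simp add: add.assoc)
  ultimately show ?case by (meson order.trans)
qed

end

section \<open>Limit key polynomials when v(p) lies in the invariance group\<close>

locale linear_limit_key_poly = linear_chain \<nu> QQ
  for \<nu> :: "'k::field poly \<Rightarrow> 'g::linordered_ab_group_add extended" and QQ +
  fixes F :: "'k poly" and h :: 'g
  assumes F_KP: "F \<in> KP_inf \<nu> QQ"
    and h_inv: "h \<in> invariance_group (Gam \<nu>) (gammaQQ_lower \<nu> QQ)"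
    and h_val: "vval \<nu> (of_nat (char_exp \<nu>)) = Fin h"
begin

lemma F_monic: "lead_coeff F = 1"
  and F_unstable: "\<not> Q_stable \<nu> QQ F"
  and lower_degree_stable: "degree g < degree F \<Longrightarrow> Q_stable \<nu> QQ g"
  using F_KP unfolding KP_inf_def by (auto dest: leD)

lemma degree_F_pos: "0 < degree F"
proof (rule ccontr)
  assume "\<not> 0 < degree F"
  then obtain c where c: "F = [:c:]" by (auto elim: degree_eq_zeroE)
  obtain Q where Q: "Q \<in> QQ" using QQ_nonempty by blast
  have "nuQ \<nu> Q F = \<nu> F"
    by (subst QQ_eq[OF Q]) (simp add: nuQ_def exp_coeff_linear c)
  then show False using unstable_nuQ_less[OF F_unstable Q] by simp
qed

lemma h_nonneg: "0 \<le> h"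
  using h_val nu_of_nat_nonneg[of "char_exp \<nu>"] by (simp add: vval_def)

text \<open>Since v(p) is the finite value h, every positive integer has finite value, so K has
  characteristic 0.\<close>

lemma of_nat_nonzero: "0 < n \<Longrightarrow> (of_nat n :: 'k) \<noteq> 0"
  using nu_of_nat_eq[OF h_val, of n] by (metis extended.distinct(1) nu_0 pCons_0_0)

lemma hasse_F_nonzero: "l \<le> degree F \<Longrightarrow> hasse l F \<noteq> 0"
proof
  assume "l \<le> degree F" "hasse l F = 0"
  then have "of_nat (degree F choose l) = (0::'k)"
    using F_monic coeff_hasse[of l F "degree F - l"] by simp
  then show False using of_nat_nonzero \<open>l \<le> degree F\<close> by (simp add: zero_less_binomial)
qed

text \<open>The ultimate value of the coefficient of index l for 1 <= l <= \<open>degree F\<close>,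
  taken from the stable polynomial \<open>hasse l F\<close>; \<open>beta_ev\<close> shows that it is
  finite there.\<close>

definition beta :: "nat \<Rightarrow> 'g" where
  "beta l = the_fin (\<nu> (hasse l F))"

lemma beta_ev:
  assumes "1 \<le> l" "l \<le> degree F"
  shows "ev (\<lambda>Q. \<nu> [:poly (hasse l F) (center Q):] = Fin (beta l)
                 \<and> nuQ \<nu> Q (hasse l F) = Fin (beta l))"
proof -
  have "Q_stable \<nu> QQ (hasse l F)"
    by (intro lower_degree_stable degree_hasse_less) (use degree_F_pos assms in auto)
  note st = stable_ev[OF this]
  then obtain Q where Q: "Q \<in> QQ" "nuQ \<nu> Q (hasse l F) = \<nu> (hasse l F)"
    using ev_ex by blast
  then have "\<nu> (hasse l F) = Fin (beta l)"
    using nuQ_linear_finite[OF hasse_F_nonzero[OF assms(2)] nu_linear_center[OF Q(1)]] QQ_eq[OF Q(1)]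
    by (metis beta_def the_fin.simps(1))
  with st show ?thesis by simp
qed

text \<open>Stability makes \<open>beta l\<close> the truncated value of \<open>hasse l F\<close>,
  which is at most its k-th term; by \<open>hasse_hasse\<close> that term is a binomial multiple of
  the derivative of order k + l. The number j comes from the binomial alone and does not depend on
  Q.\<close>

lemma beta_le:
  assumes "1 \<le> l" "k + l \<le> degree F"
  shows "\<exists>j. ev (\<lambda>Q. beta l \<le> nmul j h + beta (k + l) + nmul k (gammaQ \<nu> Q))"
proof -
  obtain j where j: "\<nu> [:of_nat ((k + l) choose k):] = Fin (nmul j h)"
    using nu_of_nat_eq[OF h_val, of "(k + l) choose k"] by (auto simp: zero_less_binomial)
  have "ev (\<lambda>Q. nuQ \<nu> Q (hasse l F) = Fin (beta l) \<and>
                \<nu> [:poly (hasse (k + l) F) (center Q):] = Fin (beta (k + l)))"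
    by (rule ev_mono[OF ev_conj[OF beta_ev[of l] beta_ev[of "k + l"]]]) (use assms in auto)
  then have "ev (\<lambda>Q. beta l \<le> nmul j h + beta (k + l) + nmul k (gammaQ \<nu> Q))"
  proof (rule ev_mono)
    fix Q assume Q: "Q \<in> QQ" and *: "nuQ \<nu> Q (hasse l F) = Fin (beta l) \<and>
                \<nu> [:poly (hasse (k + l) F) (center Q):] = Fin (beta (k + l))"
    have "[:poly (hasse k (hasse l F)) (center Q):]
        = [:of_nat ((k + l) choose k):] * [:poly (hasse (k + l) F) (center Q):]"
      by (simp add: hasse_hasse)
    then have "\<nu> [:poly (hasse k (hasse l F)) (center Q):] = Fin (nmul j h + beta (k + l))"
      using * j by (simp only: nu_mult plus_extended.simps)
    then show "beta l \<le> nmul j h + beta (k + l) + nmul k (gammaQ \<nu> Q)"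
      using nuQ_le_term[OF Q, of "hasse l F" k] * by simp
  qed
  then show ?thesis ..
qed

text \<open>Fix the estimate of \<open>beta_le\<close> at one \<open>Q0\<close>. It carries l - 1
  copies of the value of \<open>Q0\<close>; for later Q one copy absorbs the multiple of h and gives
  strictness, and the others only grow.\<close>

lemma beta_1_dominates:
  assumes "2 \<le> l" "l \<le> degree F"
  shows "ev (\<lambda>Q. beta 1 + gammaQ \<nu> Q < beta l + nmul l (gammaQ \<nu> Q))"
proof -
  obtain t where l: "l = Suc (Suc t)" using assms(1) by (auto simp: le_iff_add)
  obtain j Q0 where Q0: "Q0 \<in> QQ" "beta 1 \<le> nmul j h + beta l + nmul (Suc t) (gammaQ \<nu> Q0)"
    using beta_le[of 1 "Suc t"] assms ev_ex l by (metis Suc_eq_plus1 order_refl)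
  obtain R where R: "R \<in> QQ" "nmul j h + gammaQ \<nu> Q0 \<le> gammaQ \<nu> R"
    using invariance_bound[OF h_inv Q0(1)] by blast
  show ?thesis
  proof (rule ev_mono[OF ev_above[OF R(1)]])
    fix Q assume Q: "Q \<in> QQ" "\<nu> R < \<nu> Q"
    let ?c = "gammaQ \<nu> Q" and ?z = "gammaQ \<nu> Q0"
    have less: "nmul j h + ?z < ?c"
      using R(2) Q(2) unfolding nu_less_iff[OF R(1) Q(1)] by (rule le_less_trans)
    moreover have "?z \<le> nmul j h + ?z" using nmul_nonneg[OF h_nonneg] by simp
    ultimately have "?z \<le> ?c" by (meson le_less_trans less_imp_le)
    have "beta 1 \<le> beta l + ((nmul j h + ?z) + nmul t ?z)"
      using Q0(2) by (simp add: ac_simps)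
    also have "\<dots> < beta l + (?c + nmul t ?c)"
      using add_less_le_mono[OF less nmul_mono[OF \<open>?z \<le> ?c\<close>]] by simp
    finally show "beta 1 + ?c < beta l + nmul l ?c"
      by (simp add: l ac_simps)
  qed
qed

lemma F_expansion_ev:
  "ev (\<lambda>Q. nuQ \<nu> Q F = Fin (beta 1 + gammaQ \<nu> Q) \<and>
           \<nu> ([:poly (hasse 1 F) (center Q):] * [:- center Q, 1:] ^ 1) = Fin (beta 1 + gammaQ \<nu> Q) \<and>
           (\<forall>l\<in>{2..degree F}. Fin (beta 1 + gammaQ \<nu> Q)
               < \<nu> ([:poly (hasse l F) (center Q):] * [:- center Q, 1:] ^ l)))"
proof -
  have "ev (\<lambda>Q. \<forall>l\<in>{2..degree F}. \<nu> [:poly (hasse l F) (center Q):] = Fin (beta l)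
                \<and> beta 1 + gammaQ \<nu> Q < beta l + nmul l (gammaQ \<nu> Q))"
  proof (rule ev_ball)
    fix l assume l: "l \<in> {2..degree F}"
    show "ev (\<lambda>Q. \<nu> [:poly (hasse l F) (center Q):] = Fin (beta l)
                \<and> beta 1 + gammaQ \<nu> Q < beta l + nmul l (gammaQ \<nu> Q))"
      by (rule ev_conj[OF ev_mono[OF beta_ev[of l]] beta_1_dominates]) (use l in auto)
  qed simp
  moreover have "ev (\<lambda>Q. \<nu> [:poly (hasse 1 F) (center Q):] = Fin (beta 1))"
    by (rule ev_mono[OF beta_ev]) (use degree_F_pos in auto)
  ultimately show ?thesis
  proof (rule ev_mono[OF ev_conj])
    fix Q assume Q: "Q \<in> QQ" and *: "(\<forall>l\<in>{2..degree F}. \<nu> [:poly (hasse l F) (center Q):] = Fin (beta l)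
                \<and> beta 1 + gammaQ \<nu> Q < beta l + nmul l (gammaQ \<nu> Q)) \<and>
         \<nu> [:poly (hasse 1 F) (center Q):] = Fin (beta 1)"
    let ?t = "\<lambda>l. [:poly (hasse l F) (center Q):] * [:- center Q, 1:] ^ l" and ?y = "beta 1 + gammaQ \<nu> Q"
    have t1: "\<nu> (?t 1) = Fin ?y"
      using * by (simp only: nu_taylor_term[OF Q] plus_extended.simps nmul_Suc One_nat_def nmul_0 add_0_right)
    have t2: "\<forall>l\<in>{2..degree F}. Fin ?y < \<nu> (?t l)"
      using * by (simp only: nu_taylor_term[OF Q] plus_extended.simps less_extended_simps) simp
    have Qe: "nuQ \<nu> Q F = nuQ \<nu> [:- center Q, 1:] F" using QQ_eq[OF Q] by simp
    \<comment> \<open>Otherwise the constant term would be the only one of minimal value, making F stable.\<close>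
    have t0: "Fin ?y \<le> \<nu> (?t 0)"
    proof (rule ccontr)
      assume "\<not> Fin ?y \<le> \<nu> (?t 0)"
      then have less: "\<nu> (?t 0) < Fin ?y" by simp
      then obtain c where c: "\<nu> (?t 0) = Fin c" "c < ?y"
        using nu_not_Minf[of "?t 0"] by (cases "\<nu> (?t 0)") auto
      have gt: "Fin c < \<nu> (?t l)" if "l \<in> {1..degree F}" for l
      proof (cases "l = 1")
        case True
        then show ?thesis using t1 c by simp
      next
        case False
        then have "Fin ?y < \<nu> (?t l)" using t2 that by simp
        moreover have "Fin c < Fin ?y" using c by simp
        ultimately show ?thesis by (rule less_trans[rotated])
      qed
      define r where "r = (\<Sum>l\<in>{1..degree F}. ?t l)"
      have "F = ?t 0 + r"
        using taylor_expansion[of F "center Q"]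
        by (simp add: r_def atMost_atLeast0 sum.atLeast_Suc_atMost)
      then have "\<nu> F = \<nu> (?t 0 + r)" by (rule arg_cong)
      also have "\<dots> = \<nu> (?t 0)"
        unfolding r_def by (rule nu_add_eq_left) (unfold c, rule nu_sum_greater, rule gt)
      also note c(1)
      finally have "\<nu> F = Fin c" .
      moreover have "Fin c \<le> nuQ \<nu> Q F"
        unfolding Qe nuQ_linear_ge_iff
      proof (intro allI impI)
        fix i assume "i \<le> degree F"
        then consider "i = 0" | "i \<in> {1..degree F}" by fastforce
        then show "Fin c \<le> \<nu> (?t i)"
          by cases (use c gt less_imp_le in auto)
      qed
      ultimately show False using unstable_nuQ_less[OF F_unstable Q] by simp
    qed
    have "nuQ \<nu> Q F = Fin ?y"
    proof (rule antisym)
      show "nuQ \<nu> Q F \<le> Fin ?y"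
        unfolding Qe t1[symmetric] by (rule nuQ_linear_le)
      show "Fin ?y \<le> nuQ \<nu> Q F"
        unfolding Qe nuQ_linear_ge_iff
      proof (intro allI impI)
        fix i assume "i \<le> degree F"
        then consider "i = 0" | "i = 1" | "i \<in> {2..degree F}" by fastforce
        then show "Fin ?y \<le> \<nu> (?t i)"
        proof cases
          case 1
          then show ?thesis using t0 by simp
        next
          case 2
          then show ?thesis using t1 by simp
        next
          case 3
          then show ?thesis using t2 by (blast intro: less_imp_le)
        qed
      qed
    qed
    with t1 t2 show "nuQ \<nu> Q F = Fin ?y \<and> \<nu> (?t 1) = Fin ?y \<and> (\<forall>l\<in>{2..degree F}. Fin ?y < \<nu> (?t l))"
      by blast
  qed
qed

text \<open>The linear term attains the minimum and no higher term does. The constant term may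
  attain it too, without changing the largest index.\<close>

lemma degQ_ev: "ev (\<lambda>Q. degQ \<nu> Q F = 1)"
proof (rule ev_mono[OF F_expansion_ev])
  fix Q assume Q: "Q \<in> QQ" and *: "nuQ \<nu> Q F = Fin (beta 1 + gammaQ \<nu> Q) \<and>
           \<nu> ([:poly (hasse 1 F) (center Q):] * [:- center Q, 1:] ^ 1) = Fin (beta 1 + gammaQ \<nu> Q) \<and>
           (\<forall>l\<in>{2..degree F}. Fin (beta 1 + gammaQ \<nu> Q)
               < \<nu> ([:poly (hasse l F) (center Q):] * [:- center Q, 1:] ^ l))"
  have S: "SQ \<nu> Q F = {i. i \<le> degree F \<and>
      \<nu> ([:poly (hasse i F) (center Q):] * [:- center Q, 1:] ^ i) = Fin (beta 1 + gammaQ \<nu> Q)}"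
    using * unfolding SQ_def exp_coeff_QQ[OF Q] QQ_eq[OF Q, symmetric] by metis
  have "1 \<in> SQ \<nu> Q F"
    unfolding S mem_Collect_eq by (rule conjI) (use * degree_F_pos in auto)
  moreover have "i \<le> 1" if "i \<in> SQ \<nu> Q F" for i
  proof (rule ccontr)
    assume "\<not> i \<le> 1"
    with that have "i \<in> {2..degree F}" by (simp add: S)
    with * have "Fin (beta 1 + gammaQ \<nu> Q)
        < \<nu> ([:poly (hasse i F) (center Q):] * [:- center Q, 1:] ^ i)" by blast
    moreover have "\<dots> = Fin (beta 1 + gammaQ \<nu> Q)"
      using that unfolding S by blast
    ultimately show False by (simp only: less_irrefl)
  qed
  moreover have "finite (SQ \<nu> Q F)" by (simp add: SQ_def)
  ultimately show "degQ \<nu> Q F = 1" unfolding degQ_def by (intro Max_eqI) auto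
qed

text \<open>If \<open>(x - a)\<^sup>D\<close> had value above all \<open>\<nu>\<^sub>Q(F)\<close>, then \<open>F - (x - a)\<^sup>D\<close> would have the same
  truncated values as \<open>F\<close>, and would be an unstable polynomial of smaller degree.\<close>

lemma degree_term_bounded:
  assumes "Q0 \<in> QQ"
  shows "\<exists>R\<in>QQ. Fin (nmul (degree F) (gammaQ \<nu> Q0)) \<le> nuQ \<nu> R F"
proof (rule ccontr)
  let ?D = "degree F" and ?z = "gammaQ \<nu> Q0" and ?a = "center Q0"
  assume "\<not> ?thesis"
  then have big: "nuQ \<nu> R F < Fin (nmul ?D ?z)" if "R \<in> QQ" for R
    using that by (auto simp: not_le)
  have ev1: "ev (\<lambda>Q. nuQ \<nu> Q F = Fin (beta 1 + gammaQ \<nu> Q))"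
    by (rule ev_mono[OF F_expansion_ev]) blast
  have big': "ev (\<lambda>Q. beta 1 + gammaQ \<nu> Q < nmul ?D ?z)"
    by (rule ev_mono[OF ev1]) (use big in force)
  obtain t where t: "?D = Suc t" using degree_F_pos by (cases ?D) auto
  \<comment> \<open>Replace the value of a later Q by the smaller \<open>?z\<close> in
    \<open>big'\<close> and cancel one copy of \<open>?z\<close>.\<close>
  have beta1: "beta 1 < nmul t ?z"
  proof -
    obtain Q where "Q \<in> QQ" "beta 1 + gammaQ \<nu> Q < nmul ?D ?z" "\<nu> Q0 < \<nu> Q"
      using ev_ex[OF ev_conj[OF big' ev_above[OF assms]]] by blast
    then have "beta 1 + ?z < nmul ?D ?z"
      using assms by (auto simp: nu_less_iff intro: less_trans[OF add_strict_left_mono])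
    then show ?thesis by (simp add: t add.commute)
  qed
  define P where "P = [:- ?a, 1:] ^ ?D"
  \<comment> \<open>Both F and P are monic of the same degree, so G has smaller degree and is
    stable.\<close>
  define G where "G = F - P"
  have "degree G < ?D"
  proof -
    have P: "degree P = ?D" "coeff P ?D = 1"
      using lead_coeff_power[of "[:- ?a, 1:]" ?D] by (simp_all add: P_def degree_linear_power)
    have "degree G \<le> ?D - 1"
    proof (rule degree_le, intro allI impI)
      fix i assume "?D - 1 < i"
      then consider "i = ?D" | "?D < i" by fastforce
      then show "coeff G i = 0"
        using P F_monic by cases (simp_all add: G_def coeff_eq_0)
    qed
    then show ?thesis using degree_F_pos by simp
  qed
  note st = stable_ev[OF lower_degree_stable[OF this]]
  have Pval: "\<nu> [:poly P (center Q):] = Fin (nmul ?D ?z)"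
    and P1val: "Fin (nmul t ?z) \<le> \<nu> [:poly (hasse 1 P) (center Q):]"
    if "Q \<in> QQ" "\<nu> Q0 < \<nu> Q" for Q
  proof -
    have gap: "\<nu> [:center Q - ?a:] = Fin ?z"
      using nu_diff_gap[OF nu_linear_center[OF assms]] nu_linear_center[OF that(1)] nu_less_iff that assms
      by simp
    have "[:poly P (center Q):] = [:center Q - ?a:] ^ ?D" by (simp add: P_def poly_const_pow)
    then show "\<nu> [:poly P (center Q):] = Fin (nmul ?D ?z)" using nu_power[OF gap] by simp
    have "[:poly (hasse 1 P) (center Q):] = [:of_nat ?D:] * [:center Q - ?a:] ^ t"
      unfolding P_def hasse_1_linear_power by (simp add: poly_const_pow t mult.commute)
    then have "\<nu> [:poly (hasse 1 P) (center Q):] = \<nu> [:of_nat ?D:] + Fin (nmul t ?z)"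
      by (simp only: nu_mult nu_power[OF gap])
    then show "Fin (nmul t ?z) \<le> \<nu> [:poly (hasse 1 P) (center Q):]"
      using add_right_mono[OF nu_of_nat_nonneg[of ?D], of "Fin (nmul t ?z)"] by simp
  qed
  \<comment> \<open>The linear coefficient of P has larger value than that of F, so G inherits the
    linear term of F, which bounds its truncation from above. The constant term of G is at least as
    large. Stability equates both outer quantities with the value of G.\<close>
  have "ev (\<lambda>Q. nuQ \<nu> Q G \<le> Fin (beta 1 + gammaQ \<nu> Q) \<and>
                Fin (beta 1 + gammaQ \<nu> Q) \<le> \<nu> [:poly G (center Q):])"
  proof (rule ev_mono[OF ev_conj[OF ev_conj[OF ev_above[OF assms] big'] ev_conj[OF ev1 beta_ev[of 1]]]])
    fix Q assume Q: "Q \<in> QQ" and "(\<nu> Q0 < \<nu> Q \<and> beta 1 + gammaQ \<nu> Q < nmul ?D ?z) \<and>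
      nuQ \<nu> Q F = Fin (beta 1 + gammaQ \<nu> Q) \<and>
      \<nu> [:poly (hasse 1 F) (center Q):] = Fin (beta 1) \<and> nuQ \<nu> Q (hasse 1 F) = Fin (beta 1)"
    then have *: "\<nu> Q0 < \<nu> Q" "beta 1 + gammaQ \<nu> Q < nmul ?D ?z"
      "nuQ \<nu> Q F = Fin (beta 1 + gammaQ \<nu> Q)" "\<nu> [:poly (hasse 1 F) (center Q):] = Fin (beta 1)"
      by auto
    have "\<nu> [:poly (hasse 1 F) (center Q):] < \<nu> (- [:poly (hasse 1 P) (center Q):])"
    proof -
      have "Fin (beta 1) < Fin (nmul t ?z)" using beta1 by simp
      also note P1val[OF Q *(1)]
      finally show ?thesis using * by (simp del: minus_pCons)
    qed
    then have "\<nu> ([:poly (hasse 1 F) (center Q):] + - [:poly (hasse 1 P) (center Q):]) = Fin (beta 1)"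
      unfolding *(4)[symmetric] by (rule nu_add_eq_left)
    then have "\<nu> [:poly (hasse 1 G) (center Q):] = Fin (beta 1)"
      by (simp add: G_def hasse_diff)
    then have 1: "nuQ \<nu> Q G \<le> Fin (beta 1 + gammaQ \<nu> Q)"
      using nuQ_le_term[OF Q, of G 1] by simp
    have "Fin (beta 1 + gammaQ \<nu> Q) \<le> \<nu> [:poly F (center Q):]"
      using nuQ_le_const[OF Q, of F] * by simp
    then have "Fin (beta 1 + gammaQ \<nu> Q) \<le> min (\<nu> [:poly F (center Q):]) (\<nu> (- [:poly P (center Q):]))"
      using Pval[OF Q *(1)] * by (simp del: minus_pCons)
    also have "\<dots> \<le> \<nu> ([:poly F (center Q):] + - [:poly P (center Q):])"
      by (rule nu_add_ge)
    finally show "nuQ \<nu> Q G \<le> Fin (beta 1 + gammaQ \<nu> Q) \<and>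
                Fin (beta 1 + gammaQ \<nu> Q) \<le> \<nu> [:poly G (center Q):]"
      using 1 by (simp add: G_def)
  qed (use degree_F_pos in auto)
  \<comment> \<open>A fixed value of G cannot equal \<open>beta 1 + gammaQ \<nu> Q\<close> for all
    late Q, since the values of Q strictly increase.\<close>
  from ev_conj[OF st this] have E: "ev (\<lambda>Q. \<nu> G = Fin (beta 1 + gammaQ \<nu> Q))"
    by (rule ev_mono) auto
  then obtain Q where Q: "Q \<in> QQ" "\<nu> G = Fin (beta 1 + gammaQ \<nu> Q)" using ev_ex by blast
  obtain R where "R \<in> QQ" "\<nu> G = Fin (beta 1 + gammaQ \<nu> R)" "\<nu> Q < \<nu> R"
    using ev_ex[OF ev_conj[OF E ev_above[OF Q(1)]]] by blast
  then show False using Q by (simp add: nu_less_iff)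
qed

text \<open>Downward induction from the leading term, where \<open>beta\<close> is 0. By
  \<open>beta_le\<close> with k = 1, passing from index l + 1 to l costs a multiple of h, which the
  chain absorbs because the truncations of F grow like \<open>beta 1\<close> plus the value of
  Q.\<close>

lemma term_bounded:
  assumes "1 \<le> l" "l \<le> degree F"
  shows "ev (\<lambda>Q. \<exists>R\<in>QQ. Fin (beta l + nmul l (gammaQ \<nu> Q)) \<le> nuQ \<nu> R F)"
  using assms(2,1)
proof (induction l rule: inc_induct)
  case base
  have "beta (degree F) = 0"
    using F_monic by (simp add: beta_def hasse_degree one_pCons[symmetric])
  then show ?case
    using degree_term_bounded by (intro ev_mono[OF ev_True]) simp
next
  case (step l)
  obtain j where j: "ev (\<lambda>Q. beta l \<le> nmul j h + beta (Suc l) + nmul 1 (gammaQ \<nu> Q))"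
    using beta_le[of l 1] step by auto
  have IH: "ev (\<lambda>Q. \<exists>R\<in>QQ. Fin (beta (Suc l) + nmul (Suc l) (gammaQ \<nu> Q)) \<le> nuQ \<nu> R F)"
    using step by simp
  show ?case
  proof (rule ev_mono[OF ev_conj[OF j IH]])
    fix Q assume Q: "Q \<in> QQ" and *: "beta l \<le> nmul j h + beta (Suc l) + nmul 1 (gammaQ \<nu> Q) \<and>
       (\<exists>R\<in>QQ. Fin (beta (Suc l) + nmul (Suc l) (gammaQ \<nu> Q)) \<le> nuQ \<nu> R F)"
    then obtain R0 where R0: "R0 \<in> QQ" "Fin (beta (Suc l) + nmul (Suc l) (gammaQ \<nu> Q)) \<le> nuQ \<nu> R0 F"
      by blast
    have ev1: "ev (\<lambda>Q. nuQ \<nu> Q F = Fin (beta 1 + gammaQ \<nu> Q))"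
      by (rule ev_mono[OF F_expansion_ev]) blast
    \<comment> \<open>The formula for the truncation of F holds only for late members, so pass
      beyond \<open>R0\<close>; \<open>R2\<close> then absorbs the multiple of h, and R is again
      late enough for the formula.\<close>
    obtain R1 where R1: "R1 \<in> QQ" "nuQ \<nu> R1 F = Fin (beta 1 + gammaQ \<nu> R1)" "\<nu> R0 < \<nu> R1"
      using ev_ex[OF ev_conj[OF ev1 ev_above[OF R0(1)]]] by blast
    have "Fin (beta (Suc l) + nmul (Suc l) (gammaQ \<nu> Q)) \<le> Fin (beta 1 + gammaQ \<nu> R1)"
      using R0(2) unstable_nuQ_strict_mono[OF F_unstable R0(1) R1(1) R1(3)]
      unfolding R1(2)[symmetric] by (meson less_imp_le order.trans)
    then have r1: "beta (Suc l) + nmul (Suc l) (gammaQ \<nu> Q) \<le> beta 1 + gammaQ \<nu> R1" by simp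
    obtain R2 where R2: "R2 \<in> QQ" "nmul j h + gammaQ \<nu> R1 \<le> gammaQ \<nu> R2"
      using invariance_bound[OF h_inv R1(1)] by blast
    obtain R where R: "R \<in> QQ" "nuQ \<nu> R F = Fin (beta 1 + gammaQ \<nu> R)" "\<nu> R2 < \<nu> R"
      using ev_ex[OF ev_conj[OF ev1 ev_above[OF R2(1)]]] by blast
    have "beta l + nmul l (gammaQ \<nu> Q)
        \<le> (nmul j h + beta (Suc l) + nmul 1 (gammaQ \<nu> Q)) + nmul l (gammaQ \<nu> Q)"
      using * by (intro add_right_mono) blast
    also have "\<dots> = nmul j h + (beta (Suc l) + nmul (Suc l) (gammaQ \<nu> Q))"
      by (simp add: ac_simps)
    also have "\<dots> \<le> nmul j h + (beta 1 + gammaQ \<nu> R1)"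
      using r1 by (rule add_left_mono)
    also have "\<dots> = beta 1 + (nmul j h + gammaQ \<nu> R1)"
      by (simp add: ac_simps)
    also have "\<dots> \<le> beta 1 + gammaQ \<nu> R2"
      using R2(2) by (rule add_left_mono)
    also have "\<dots> \<le> beta 1 + gammaQ \<nu> R"
      using R R2 by (simp add: nu_less_iff)
    finally show "\<exists>R\<in>QQ. Fin (beta l + nmul l (gammaQ \<nu> Q)) \<le> nuQ \<nu> R F"
      using R by (intro bexI[of _ R]) simp_all
  qed
qed

section \<open>Determination of the index set \<open>Bct\<close>\<close>

lemma Bct_supset:
  assumes "1 \<le> l" "l \<le> degree F"
  shows "l \<in> Bct \<nu> QQ 1 F"
proof -
  have coeff: "ev (\<lambda>Q. \<nu> (exp_coeff Q F l) = Fin (beta l))"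
  proof (rule ev_mono[OF beta_ev[OF assms]])
    fix Q assume "Q \<in> QQ" and *: "\<nu> [:poly (hasse l F) (center Q):] = Fin (beta l) \<and>
      nuQ \<nu> Q (hasse l F) = Fin (beta l)"
    then show "\<nu> (exp_coeff Q F l) = Fin (beta l)"
      by (simp add: exp_coeff_QQ)
  qed
  then have "ult_const \<nu> QQ (\<lambda>Q. \<nu> (exp_coeff Q F l))"
    unfolding eventually_Q_def ult_const_def by (metis order_refl)
  moreover have "l \<notin> Jset \<nu> QQ 1 F"
  proof
    assume "l \<in> Jset \<nu> QQ 1 F"
    then have J: "ev (\<lambda>Q. above_cut (Gam \<nu>) (deltaL \<nu> QQ F)
          (\<nu> (exp_coeff Q F l) + Fin (nmul l (gammaQ \<nu> Q))))"
      by (simp add: Jset_def)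
    \<comment> \<open>At a common late Q the value of the l-th term would lie both above the cut
      and, by \<open>term_bounded\<close>, in its lower set.\<close>
    show False
      using ev_ex[OF ev_conj[OF J ev_conj[OF coeff term_bounded[OF assms]]]]
      by (auto simp: above_cut_def deltaL_def)
  qed
  ultimately show ?thesis using assms by (simp add: Bct_def Bset_def)
qed

text \<open>If the constant coefficient had a constant value y in the lower set, some truncation of
  F would reach y. All late truncations stay at or below the constant term, hence at or below y,
  although they strictly increase.\<close>

lemma zero_notin_Bct: "0 \<notin> Bct \<nu> QQ 1 F"
proof
  assume "0 \<in> Bct \<nu> QQ 1 F"
  then have u: "ult_const \<nu> QQ (\<lambda>Q. \<nu> (exp_coeff Q F 0))"
    and J: "\<not> ev (\<lambda>Q. above_cut (Gam \<nu>) (deltaL \<nu> QQ F)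
                  (\<nu> (exp_coeff Q F 0) + Fin (nmul 0 (gammaQ \<nu> Q))))"
    by (simp_all add: Bct_def Bset_def Jset_def)
  from u obtain Q0 where Q0: "Q0 \<in> QQ"
      "\<And>Q. Q \<in> QQ \<Longrightarrow> \<nu> Q0 \<le> \<nu> Q \<Longrightarrow> \<nu> (exp_coeff Q F 0) = \<nu> (exp_coeff Q0 F 0)"
    unfolding ult_const_def by blast
  obtain Q1 where Q1: "Q1 \<in> QQ" "\<nu> Q0 \<le> \<nu> Q1"
      "\<not> above_cut (Gam \<nu>) (deltaL \<nu> QQ F) (\<nu> (exp_coeff Q1 F 0) + Fin 0)"
    using J Q0(1) unfolding eventually_Q_def nmul_0 by blast
  have e: "exp_coeff Q F 0 = [:poly F (center Q):]" if "Q \<in> QQ" for Q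
    using exp_coeff_QQ[OF that, of F 0] by simp
  have "poly F (center Q1) \<noteq> 0"
    using Q1 by (auto simp: e above_cut_def)
  then obtain y where y: "\<nu> [:poly F (center Q1):] = Fin y" by (rule nu_const_finite)
  have "y \<in> Gam \<nu>"
    using y \<open>poly F (center Q1) \<noteq> 0\<close> by (intro valgrpK_in_Gam) (auto simp: valgrpK_def vval_def)
  then obtain R where R: "R \<in> QQ" "Fin y \<le> nuQ \<nu> R F"
    using Q1 y by (auto simp: e above_cut_def deltaL_def)
  obtain R' where R': "R' \<in> QQ" "\<nu> R < \<nu> R'" "\<nu> Q0 < \<nu> R'"
    using ev_ex[OF ev_conj[OF ev_above[OF R(1)] ev_above[OF Q0(1)]]] by blast
  have "nuQ \<nu> R' F \<le> \<nu> [:poly F (center R'):]"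
    by (rule nuQ_le_const[OF R'(1)])
  also have "\<dots> = Fin y"
    using Q0 Q1 R' y e by (metis less_imp_le)
  finally show False
    using R unstable_nuQ_strict_mono[OF F_unstable R(1) R'(1) R'(2)] by simp
qed

lemma Bct_eq: "Bct \<nu> QQ 1 F = {1..degree F}"
proof -
  have "Bct \<nu> QQ 1 F \<subseteq> {0..degree F}" by (auto simp: Bct_def Bset_def)
  moreover have "l \<noteq> 0" if "l \<in> Bct \<nu> QQ 1 F" for l using that zero_notin_Bct by metis
  ultimately show ?thesis using Bct_supset by (force simp: Suc_le_eq)
qed

end

theorem mainTheorem18:
  fixes \<nu> :: "'k::field poly \<Rightarrow> 'g::linordered_ab_group_add extended"
    and QQ :: "'k poly set" and m :: nat and F :: "'k poly"
  assumes divisible: "divisible_group TYPE('g)"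
    and val: "is_valuation \<nu>"
    and wspec: "well_specified \<nu>"
    and Psi_ne: "Psi \<nu> m \<noteq> {}"
    and Psi_nomax: "\<forall>P\<in>Psi \<nu> m. \<exists>P'\<in>Psi \<nu> m. \<nu> P < \<nu> P'"
    and QQ_sub: "QQ \<subseteq> Psi \<nu> m"
    and QQ_inj: "inj_on \<nu> QQ"
    and QQ_wo: "\<forall>S\<subseteq>QQ. S \<noteq> {} \<longrightarrow> (\<exists>Q\<in>S. \<forall>R\<in>S. \<nu> Q \<le> \<nu> R)"
    and QQ_cofinal: "\<forall>P\<in>Psi \<nu> m. \<exists>Q\<in>QQ. \<nu> P \<le> \<nu> Q"
    and unstable_ex: "\<exists>f. \<not> Q_stable \<nu> QQ f"
    and F_KP: "F \<in> KP_inf \<nu> QQ"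
    and vert_unb: "\<not> vertically_bounded (gammaQQ_lower \<nu> QQ)"
    and m1: "m = 1"
    and vp_H: "\<exists>h\<in>invariance_group (Gam \<nu>) (gammaQQ_lower \<nu> QQ).
                 vval \<nu> (of_nat (char_exp \<nu>)) = Fin h"
  shows "eventually_Q \<nu> QQ (\<lambda>Q. degQ \<nu> Q F = 1) \<and>
         Bct \<nu> QQ m F = {1..degree F div m}"
proof -
  obtain h where h: "h \<in> invariance_group (Gam \<nu>) (gammaQQ_lower \<nu> QQ)"
      "vval \<nu> (of_nat (char_exp \<nu>)) = Fin h"
    using vp_H by blast
  interpret linear_limit_key_poly \<nu> QQ F h
  proof
    show "is_valuation \<nu>" by (rule val)
    show "lead_coeff Q = 1" "degree Q = 1" if "Q \<in> QQ" for Q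
      using that QQ_sub m1 by (auto simp: Psi_def key_poly_def)
    show "QQ \<noteq> {}" using Psi_ne QQ_cofinal by blast
    \<comment> \<open>A key polynomial of larger value exists, and cofinality puts a member of the
      chain at or above it.\<close>
    show "\<exists>R\<in>QQ. \<nu> Q < \<nu> R" if "Q \<in> QQ" for Q
      using that QQ_sub Psi_nomax QQ_cofinal by (meson less_le_trans subsetD)
  qed (use F_KP h in auto)
  show ?thesis using degQ_ev Bct_eq m1 by simp
qed

end
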